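(* Let $p,q\in\mathbb{Q}$ and let $D_{pq}=\left(\frac{p}{3}\right)^3+\left(\frac{q}{2}\right)^2$. For the cubic polynomial $x^3+px+q$, the following conditions are equivalent: (i) the polynomial $x^3+px+q$ is $1$-solvable; (ii) the equation $x^3+px+q=0$ has a root of the form $a+br+cr^2$, where $r\in\mathbb{R}$ and $a,b,c,r^3\in\mathbb{Q}$; (iii) either $x^3+px+q$ has a rational root, or $D_{pq}\ge 0$ and $\sqrt{D_{pq}}\in\mathbb{Q}$.
   Context: A polynomial with rational coefficients is called $1$-solvable if it has a root $x\in\mathbb{Q}[r]$ for some $r\in\mathbb{R}$ such that $r^m\in\mathbb{Q}$ for some positive integer $m$. Here $\mathbb{Q}[r]=\{A(r): A \text{ a polynomial with rational coefficients}\}$. *)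

theory Defs
  imports Complex_Main "HOL-Computational_Algebra.Polynomial"
begin

definition real_poly :: "rat poly \<Rightarrow> real poly" where
  "real_poly f = map_poly of_rat f"

text \<open>The set of all values \<open>A(r)\<close>, where \<open>A\<close> ranges over the polynomials with rational coefficients.\<close>

definition rat_adjoin :: "real \<Rightarrow> real set" where
  "rat_adjoin r = range (\<lambda>A :: rat poly. poly (real_poly A) r)"

definition one_solvable :: "rat poly \<Rightarrow> bool" where
  "one_solvable f \<longleftrightarrow>
     (\<exists>r :: real. (\<exists>m :: nat. m > 0 \<and> r ^ m \<in> \<rat>) \<and>
        (\<exists>x \<in> rat_adjoin r. poly (real_poly f) x = 0))"

text \<open>The polynomial \<open>x\<^sup>3 + p x + q\<close>; the coefficient list starts with the constant term.\<close>

definition depressed_cubic :: "rat \<Rightarrow> rat \<Rightarrow> rat poly" where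
  "depressed_cubic p q = [:q, p, 0, 1:]"

definition cubic_D :: "rat \<Rightarrow> rat \<Rightarrow> rat" where
  "cubic_D p q = (p / 3) ^ 3 + (q / 2) ^ 2"

end

theory Submission
  imports Defs "HOL-Computational_Algebra.Fundamental_Theorem_Algebra"
begin

text \<open>
  The heart of the equivalence is that a root \<open>x\<close> expressible by a single real radical \<open>r\<close> is
  already expressible by a real cube root, provided the cubic has no rational root. Galois theory
  is replaced by one fact about real radicals (\<open>power_closed_of_root\<close>): if \<open>K\<close> is a subfield of the
  reals and \<open>r ^ m \<in> K\<close>, then the degree of \<open>r\<close> over \<open>K\<close> is the least \<open>k > 0\<close> with \<open>r ^ k \<in> K\<close>. The
  minimal polynomial of \<open>r\<close> over \<open>K\<close> divides \<open>X ^ m - r ^ m\<close>, so all of its complex roots have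
  modulus \<open>\<bar>r\<bar>\<close>; hence its constant term is \<open>\<plusminus> r ^ k\<close>, where \<open>k\<close> is its degree. Because \<open>K\<close> is real,
  no root of unity can hide in this constant.

  The fact is applied twice. Over \<open>K = \<rat>(x)\<close> it shows that \<open>s = r ^ k\<close>, for the least \<open>k > 0\<close> with
  \<open>r ^ k \<in> \<rat>(x)\<close>, is irrational: if \<open>s\<close> were rational, \<open>x\<close> would be a rational polynomial of degree
  below \<open>k\<close> in \<open>r\<close>, and the independence of \<open>1, r, \<dots>, r ^ (k - 1)\<close> over \<open>K\<close> would force \<open>x \<in> \<rat>\<close>.
  Over \<open>\<rat>\<close> it shows that the degree \<open>n\<close> of \<open>s\<close> is the least \<open>n > 0\<close> with \<open>s ^ n \<in> \<rat>\<close>. As \<open>\<rat>(x)\<close> has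
  dimension at most \<open>3\<close> and contains \<open>s\<close>, either \<open>n = 2\<close> or \<open>n = 3\<close>. In the first case \<open>x\<close> lies in
  \<open>\<rat>(s)\<close>, and the cubic has the rational root \<open>- (x + x')\<close>, where \<open>x'\<close> is the conjugate of \<open>x\<close>. In the
  second case \<open>x = a + b s + c s\<^sup>2\<close> with \<open>s\<^sup>3\<close> rational (\<open>cubic_root_in_simple_radical\<close>).

  A root \<open>a + b r + c r\<^sup>2\<close> with \<open>1, r, r\<^sup>2\<close> independent over \<open>\<rat>\<close> determines \<open>p\<close> and \<open>q\<close> by comparison
  of coefficients: \<open>a = 0\<close>, \<open>p = - 3 b c r\<^sup>3\<close> and \<open>q = - (b\<^sup>3 r\<^sup>3 + c\<^sup>3 r\<^sup>6)\<close>, which makes \<open>D\<close> the square of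
  \<open>(b\<^sup>3 r\<^sup>3 - c\<^sup>3 r\<^sup>6) / 2\<close> (\<open>cubic_D_square_of_simple_radical_root\<close>). Conversely, Cardano's formula
  gives such a root when \<open>D\<close> is a rational square (\<open>cardano_root\<close>).
\<close>

section \<open>Evaluating rational polynomials at real points\<close>

lemma coeff_real_poly [simp]: "coeff (real_poly A) i = of_rat (coeff A i)"
  by (simp add: real_poly_def coeff_map_poly)

lemma real_poly_pCons [simp]: "real_poly (pCons a A) = pCons (of_rat a) (real_poly A)"
  by (simp add: real_poly_def map_poly_pCons)

lemma real_poly_0 [simp]: "real_poly 0 = 0"
  by (simp add: real_poly_def)

lemma real_poly_add [simp]: "real_poly (A + B) = real_poly A + real_poly B"
  by (rule poly_eqI) (simp add: of_rat_add)

lemma real_poly_minus [simp]: "real_poly (- A) = - real_poly A"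
  by (rule poly_eqI) (simp add: of_rat_minus)

lemma real_poly_smult [simp]: "real_poly (smult c A) = smult (of_rat c) (real_poly A)"
  by (rule poly_eqI) (simp add: of_rat_mult)

lemma real_poly_mult [simp]: "real_poly (A * B) = real_poly A * real_poly B"
  by (induction A) simp_all

lemma degree_real_poly [simp]: "degree (real_poly A) = degree A"
  unfolding real_poly_def by (rule degree_map_poly) simp

lemma real_poly_eq_0_iff [simp]: "real_poly A = 0 \<longleftrightarrow> A = 0"
  by (simp add: poly_eq_iff)

lemma real_poly_monom [simp]: "real_poly (monom c n) = monom (of_rat c) n"
  by (rule poly_eqI) (simp add: coeff_monom)

lemma poly_real_poly_of_rat: "poly (real_poly A) (of_rat x) = of_rat (poly A x)"
  by (induction A) (simp_all add: of_rat_add of_rat_mult)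

section \<open>The field obtained by adjoining a real algebraic number\<close>

lemma rat_adjoin_I: "poly (real_poly A) x \<in> rat_adjoin x"
  by (auto simp: rat_adjoin_def)

lemma rat_adjoin_E:
  assumes "y \<in> rat_adjoin x"
  obtains A where "y = poly (real_poly A) x"
  using assms by (auto simp: rat_adjoin_def)

lemma of_rat_in_rat_adjoin: "of_rat c \<in> rat_adjoin x"
  using rat_adjoin_I[of "[:c:]" x] by simp

lemma self_in_rat_adjoin: "x \<in> rat_adjoin x"
  using rat_adjoin_I[of "[:0, 1:]" x] by simp

lemma rat_adjoin_add: "a \<in> rat_adjoin x \<Longrightarrow> b \<in> rat_adjoin x \<Longrightarrow> a + b \<in> rat_adjoin x"
  by (metis rat_adjoin_E rat_adjoin_I real_poly_add poly_add)

lemma rat_adjoin_uminus: "a \<in> rat_adjoin x \<Longrightarrow> - a \<in> rat_adjoin x"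
  by (metis rat_adjoin_E rat_adjoin_I real_poly_minus poly_minus)

lemma rat_adjoin_mult: "a \<in> rat_adjoin x \<Longrightarrow> b \<in> rat_adjoin x \<Longrightarrow> a * b \<in> rat_adjoin x"
  by (metis rat_adjoin_E rat_adjoin_I real_poly_mult poly_mult)

lemma rat_adjoin_power: "a \<in> rat_adjoin x \<Longrightarrow> a ^ n \<in> rat_adjoin x"
proof (induction n)
  case 0
  then show ?case using of_rat_in_rat_adjoin[of 1 x] by simp
qed (auto intro: rat_adjoin_mult)

lemma rat_adjoin_reduce:
  assumes "g \<noteq> 0" "poly (real_poly g) x = 0" "y \<in> rat_adjoin x"
  obtains B where "degree B < degree g" "y = poly (real_poly B) x"
proof -
  obtain A where A: "y = poly (real_poly A) x" using assms(3) by (rule rat_adjoin_E)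
  have "degree g > 0"
  proof (rule ccontr)
    assume "\<not> degree g > 0"
    then obtain c where "g = [:c:]" by (auto elim: degree_eq_zeroE)
    with assms show False by simp
  qed
  then have "degree (A mod g) < degree g"
    using degree_mod_less[OF assms(1), of A] by auto
  moreover have "y = poly (real_poly (A mod g)) x"
  proof -
    have "real_poly A = real_poly (A div g) * real_poly g + real_poly (A mod g)"
      by (metis div_mult_mod_eq real_poly_add real_poly_mult)
    then show ?thesis using assms(2) A by simp
  qed
  ultimately show ?thesis using that by blast
qed

text \<open>
  If \<open>f\<close> is a nonzero polynomial of least degree that vanishes at \<open>x\<close>, no nonzero polynomial of
  smaller degree does. Reducing \<open>f\<close> modulo \<open>u\<close> therefore expresses the inverse of \<open>u(x)\<close> by that of
  \<open>(f mod u)(x)\<close>, and the degree drops, as in the Euclidean algorithm for \<open>u\<close> and \<open>f\<close>.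
\<close>
lemma rat_adjoin_inverse:
  assumes "g \<noteq> 0" "poly (real_poly g) x = 0" "y \<in> rat_adjoin x"
  shows "inverse y \<in> rat_adjoin x"
proof -
  define P where "P g \<longleftrightarrow> g \<noteq> 0 \<and> poly (real_poly g) x = 0" for g
  define f where "f = arg_min degree P"
  have Pf: "P f" and min: "\<And>h. P h \<Longrightarrow> degree f \<le> degree h"
    using arg_min_nat_lemma[of P g degree] assms unfolding f_def P_def by auto
  have main: "inverse (poly (real_poly u) x) \<in> rat_adjoin x"
    if "degree u < degree f" for u
    using that
  proof (induction "degree u" arbitrary: u rule: less_induct)
    case less
    show ?case
    proof (cases "degree u = 0")
      case True
      then obtain c where "u = [:c:]" by (auto elim: degree_eq_zeroE)
      then show ?thesis using of_rat_in_rat_adjoin[of "inverse c" x] by (simp add: of_rat_inverse)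
    next
      case False
      then have u0: "u \<noteq> 0" by auto
      define q where "q = f div u"
      define w where "w = f mod u"
      have f: "f = q * u + w" by (simp add: q_def w_def)
      have w_ne: "w \<noteq> 0"
      proof
        assume "w = 0"
        with f have fq: "f = q * u" by simp
        with Pf have "q \<noteq> 0" by (auto simp: P_def)
        then have "degree f = degree q + degree u" using fq u0 by (simp add: degree_mult_eq)
        with False have "degree q < degree f" by simp
        with min[of q] \<open>q \<noteq> 0\<close> have "poly (real_poly q) x \<noteq> 0" by (auto simp: P_def)
        moreover have "poly (real_poly u) x \<noteq> 0"
          using min[of u] less.prems u0 by (auto simp: P_def)
        ultimately show False using Pf fq by (simp add: P_def)
      qed
      have dw: "degree w < degree u"
        using degree_mod_less'[OF u0, of f] w_ne by (simp add: w_def)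
      then have inv: "inverse (poly (real_poly w) x) \<in> rat_adjoin x"
        using less by simp
      have "poly (real_poly w) x \<noteq> 0"
        using min[of w] dw less.prems w_ne by (auto simp: P_def)
      moreover have "poly (real_poly u) x * poly (real_poly q) x + poly (real_poly w) x = 0"
        using Pf unfolding P_def by (subst (asm) f) (simp add: mult.commute)
      ultimately have "inverse (poly (real_poly u) x)
          = - (poly (real_poly q) x) * inverse (poly (real_poly w) x)"
        by (cases "poly (real_poly u) x = 0") (auto simp: field_simps)
      then show ?thesis
        using inv by (metis rat_adjoin_I rat_adjoin_mult rat_adjoin_uminus)
    qed
  qed
  from assms(3) Pf obtain B where "degree B < degree f" "y = poly (real_poly B) x"
    unfolding P_def by (metis rat_adjoin_reduce)
  then show ?thesis using main by simp
qed

lemma rat_vector_space: "vector_space (\<lambda>(c :: rat) (x :: real). of_rat c * x)"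
  by unfold_locales (simp_all add: algebra_simps of_rat_add of_rat_mult)

text \<open>
  The powers of \<open>x\<close> below the degree of \<open>g\<close> span \<open>\<rat>(x)\<close>, so one vector more is a dependent family.
  The vectors are given as a family and not as a set, so that coinciding members count as dependent.
\<close>
lemma rat_adjoin_dependent:
  fixes v :: "nat \<Rightarrow> real"
  assumes "g \<noteq> 0" "poly (real_poly g) x = 0" and v: "\<And>i. i \<le> degree g \<Longrightarrow> v i \<in> rat_adjoin x"
  obtains c :: "nat \<Rightarrow> rat" and i
    where "i \<le> degree g" "c i \<noteq> 0" "(\<Sum>i\<le>degree g. of_rat (c i) * v i) = 0"
proof -
  interpret V: vector_space "\<lambda>(c :: rat) (x :: real). of_rat c * x"
    by (rule rat_vector_space)
  let ?d = "degree g"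
  show ?thesis
  proof (cases "inj_on v {..?d}")
    case False
    then obtain i j where ij: "i \<le> ?d" "j \<le> ?d" "i \<noteq> j" "v i = v j"
      by (auto simp: inj_on_def)
    define c :: "nat \<Rightarrow> rat" where "c k = (if k = i then 1 else 0) - (if k = j then 1 else 0)" for k
    have "(\<Sum>k\<le>?d. of_rat (c k) * v k)
        = (\<Sum>k\<le>?d. (if k = i then v k else 0) - (if k = j then v k else 0))"
      by (rule sum.cong) (auto simp: c_def)
    also have "\<dots> = 0"
      using ij by (simp add: sum_subtractf)
    finally have "(\<Sum>k\<le>?d. of_rat (c k) * v k) = 0" .
    moreover have "c i \<noteq> 0" using ij by (simp add: c_def)
    ultimately show ?thesis using that ij by blast
  next
    case True
    let ?T = "(\<lambda>i. x ^ i) ` {..<?d}"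
    have "v i \<in> V.span ?T" if i: "i \<le> ?d" for i
    proof -
      obtain B where B: "degree B < ?d" "v i = poly (real_poly B) x"
        by (rule rat_adjoin_reduce[OF assms(1,2) v[OF i]])
      have "v i = (\<Sum>k\<le>degree B. of_rat (coeff B k) * x ^ k)"
        by (simp add: B(2) poly_altdef)
      then show ?thesis
        using B(1) by (simp only:) (intro V.span_sum V.span_scale V.span_base imageI, simp)
    qed
    then have "v ` {..?d} \<subseteq> V.span ?T" by auto
    moreover have "card (v ` {..?d}) > card ?T"
      using card_image_le[of "{..<?d}" "\<lambda>i. x ^ i"] True by (simp add: card_image)
    ultimately have "V.dependent (v ` {..?d})"
      using V.independent_span_bound[of ?T "v ` {..?d}"] by auto
    then obtain u where u: "\<exists>y\<in>v ` {..?d}. u y \<noteq> 0" "(\<Sum>y\<in>v ` {..?d}. of_rat (u y) * y) = 0"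
      using V.dependent_finite[of "v ` {..?d}"] by auto
    from u(1) obtain i where "i \<le> ?d" "u (v i) \<noteq> 0" by auto
    moreover from u(2) have "(\<Sum>k\<le>?d. of_rat (u (v k)) * v k) = 0"
      by (simp add: sum.reindex[OF True])
    ultimately show ?thesis using that[of i "u \<circ> v"] by simp
  qed
qed

section \<open>Real radicals over a real field\<close>

locale real_subfield =
  fixes K :: "real set"
  assumes zero_closed: "0 \<in> K"
    and one_closed: "1 \<in> K"
    and add_closed: "a \<in> K \<Longrightarrow> b \<in> K \<Longrightarrow> a + b \<in> K"
    and uminus_closed: "a \<in> K \<Longrightarrow> - a \<in> K"
    and mult_closed: "a \<in> K \<Longrightarrow> b \<in> K \<Longrightarrow> a * b \<in> K"
    and inverse_closed: "a \<in> K \<Longrightarrow> inverse a \<in> K"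

lemma real_subfield_Rats: "real_subfield \<rat>"
  by unfold_locales auto

lemma real_subfield_rat_adjoin:
  assumes "g \<noteq> 0" "poly (real_poly g) x = 0"
  shows "real_subfield (rat_adjoin x)"
  using of_rat_in_rat_adjoin[of 0 x] of_rat_in_rat_adjoin[of 1 x] assms
  by unfold_locales
    (auto intro: rat_adjoin_add rat_adjoin_uminus rat_adjoin_mult rat_adjoin_inverse)

text \<open>
  Every complex root of \<open>h\<close> is an \<open>m\<close>-th root of \<open>r ^ m\<close> and so has modulus \<open>\<bar>r\<bar>\<close>. Up to sign, the
  constant coefficient is the leading one times the product of the roots.
\<close>
lemma abs_coeff_0_of_dvd_binomial:
  fixes h :: "real poly" and r :: real
  assumes "m > 0" and dvd: "h dvd monom 1 m - [:r ^ m:]" and "h \<noteq> 0"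
  shows "\<bar>coeff h 0\<bar> = \<bar>lead_coeff h\<bar> * \<bar>r\<bar> ^ degree h"
proof -
  let ?c = "map_poly (of_real :: real \<Rightarrow> complex)"
  have c_coeff: "coeff (?c p) i = of_real (coeff p i)" for p i
    by (simp add: coeff_map_poly)
  have c_mult: "?c (p * q) = ?c p * ?c q" for p q
    by (rule poly_eqI) (simp add: c_coeff coeff_mult)
  obtain g where g: "monom 1 m - [:r ^ m:] = h * g" using dvd by (elim dvdE)
  have c_binom: "?c (monom 1 m - [:r ^ m:]) = monom 1 m - [:of_real (r ^ m):]"
    by (rule poly_eqI) (auto simp: c_coeff coeff_monom coeff_pCons split: nat.splits)
  have root: "norm z = \<bar>r\<bar>" if "poly (?c h) z = 0" for z
  proof -
    have "poly (?c (monom 1 m - [:r ^ m:])) z = 0"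
      by (simp only: g c_mult poly_mult that) simp
    then have "z ^ m = of_real (r ^ m)"
      by (simp add: c_binom poly_monom)
    then have "norm z ^ m = \<bar>r\<bar> ^ m"
      by (metis norm_of_real norm_power power_abs)
    then show ?thesis
      using \<open>m > 0\<close> by (metis abs_ge_zero norm_ge_zero power_eq_iff_eq_base)
  qed
  have "?c h \<noteq> 0" using \<open>h \<noteq> 0\<close> by (simp add: poly_eq_iff c_coeff)
  then obtain A where A: "size A = degree (?c h)"
      "?c h = smult (lead_coeff (?c h)) (\<Prod>z\<in>#A. [:- z, 1:])"
    using alg_closed_imp_factorization by blast
  have deg: "degree (?c h) = degree h" by (rule degree_map_poly) simp
  have in_A: "norm z = \<bar>r\<bar>" if "z \<in># A" for z
  proof (rule root)
    obtain B where "A = add_mset z B" using \<open>z \<in># A\<close> by (metis mset_add)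
    then show "poly (?c h) z = 0" by (subst A(2)) simp
  qed
  have prod: "norm (poly (\<Prod>z\<in>#A. [:- z, 1:]) 0) = \<bar>r\<bar> ^ size A"
    using in_A by (induction A) (simp_all add: norm_mult)
  have "\<bar>coeff h 0\<bar> = norm (poly (?c h) 0)"
    by (simp add: poly_0_coeff_0 c_coeff)
  also have "\<dots> = norm (lead_coeff (?c h)) * \<bar>r\<bar> ^ size A"
    by (subst A(2)) (simp add: norm_mult prod)
  finally show ?thesis by (simp add: A(1) deg c_coeff)
qed

context real_subfield
begin

lemma diff_closed: "a \<in> K \<Longrightarrow> b \<in> K \<Longrightarrow> a - b \<in> K"
  using add_closed[of a "- b"] uminus_closed[of b] by simp

text \<open>
  Long division by \<open>h\<close>, one leading term at a time, so that every intermediate remainder visibly has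
  coefficients in \<open>K\<close>; scaling by the leading coefficient of \<open>h\<close> avoids division in \<open>K\<close>.
\<close>
lemma minimal_poly_dvd:
  assumes h: "h \<noteq> 0" "\<And>i. coeff h i \<in> K" "poly h r = 0"
    and min: "\<And>p. p \<noteq> 0 \<Longrightarrow> (\<And>i. coeff p i \<in> K) \<Longrightarrow> poly p r = 0 \<Longrightarrow> degree h \<le> degree p"
    and g: "\<And>i. coeff g i \<in> K" "poly g r = 0"
  shows "h dvd g"
  using g
proof (induction "degree g" arbitrary: g rule: less_induct)
  case (less g)
  show ?case
  proof (cases "g = 0")
    case False
    then have le: "degree h \<le> degree g" using min less.prems by blast
    define t where "t = monom (lead_coeff g) (degree g - degree h)"
    define g' where "g' = smult (lead_coeff h) g - t * h"
    have K: "coeff g' i \<in> K" for i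
    proof -
      have "coeff g' i = lead_coeff h * coeff g i - (if degree g - degree h \<le> i
          then lead_coeff g * coeff h (i - (degree g - degree h)) else 0)"
        by (simp add: g'_def t_def coeff_monom_mult)
      then show ?thesis
        using h(2) less.prems(1) zero_closed diff_closed mult_closed by simp
    qed
    have r: "poly g' r = 0" using h(3) less.prems(2) by (simp add: g'_def)
    have "degree (t * h) = degree g"
      using False h(1) le by (simp add: t_def degree_mult_eq degree_monom_eq)
    then have "degree g' \<le> degree g" unfolding g'_def
      by (metis degree_diff_le degree_smult_le order_refl)
    moreover have "coeff g' (degree g) = 0"
      using le by (simp add: g'_def t_def coeff_monom_mult)
    ultimately have "g' = 0 \<or> degree g' < degree g"
      by (metis eq_zero_or_degree_less)
    then have "h dvd g'" using less.hyps K r by auto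
    then have "h dvd g' + t * h" by simp
    then have "h dvd smult (lead_coeff h) g" by (simp add: g'_def)
    then show ?thesis using h(1) by (simp add: dvd_smult_iff)
  qed simp
qed

text \<open>
  If \<open>h\<close> is a minimal polynomial of \<open>r\<close> over \<open>K\<close>, the preceding lemmas show that \<open>r ^ degree h\<close>
  agrees, up to sign, with a quotient of two coefficients of \<open>h\<close>. That \<open>K\<close> consists of real numbers
  is essential: the sign is the only ambiguity left by the absolute value.
\<close>
lemma power_closed_of_root:
  assumes m: "m > 0" "r ^ m \<in> K"
    and g: "g \<noteq> 0" "\<And>i. coeff g i \<in> K" "poly g r = 0"
  shows "\<exists>k. 0 < k \<and> k \<le> degree g \<and> r ^ k \<in> K"
proof -
  define P where "P g \<longleftrightarrow> g \<noteq> 0 \<and> (\<forall>i. coeff g i \<in> K) \<and> poly g r = 0" for g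
  define h where "h = arg_min degree P"
  have Ph: "P h" and min: "\<And>p. P p \<Longrightarrow> degree h \<le> degree p"
    using arg_min_nat_lemma[of P g degree] g unfolding h_def P_def by auto
  have h: "h \<noteq> 0" "\<And>i. coeff h i \<in> K" "poly h r = 0" using Ph by (auto simp: P_def)
  have "coeff (monom 1 m - [:r ^ m:]) i \<in> K" for i
    using m zero_closed one_closed uminus_closed
    by (cases i) (auto simp: coeff_monom)
  moreover have "poly (monom 1 m - [:r ^ m:]) r = 0" by (simp add: poly_monom)
  ultimately have "h dvd monom 1 m - [:r ^ m:]"
    using minimal_poly_dvd[OF h] min by (simp add: P_def)
  then have "\<bar>coeff h 0\<bar> = \<bar>lead_coeff h\<bar> * \<bar>r\<bar> ^ degree h"
    using abs_coeff_0_of_dvd_binomial m(1) h(1) by blast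
  then have "\<bar>r ^ degree h\<bar> = \<bar>coeff h 0 * inverse (lead_coeff h)\<bar>"
    using h(1) by (simp add: abs_mult power_abs field_simps)
  moreover have "coeff h 0 * inverse (lead_coeff h) \<in> K"
    using h(2) by (intro mult_closed inverse_closed)
  ultimately have "r ^ degree h \<in> K"
    using uminus_closed by (metis abs_eq_iff)
  moreover have "degree h > 0"
    using h(1,3) by (metis degree_eq_zeroE gr0I pCons_0_0 poly_const_conv)
  moreover have "degree h \<le> degree g" using min g by (auto simp: P_def)
  ultimately show ?thesis by blast
qed

text \<open>
  This is the form in which the result is applied: the powers of \<open>r\<close> below the first positive one
  that lies in \<open>K\<close> are linearly independent over \<open>K\<close>.
\<close>
lemma poly_eq_0_of_degree_less:
  assumes "m > 0" "r ^ m \<in> K"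
    and "\<And>j. 0 < j \<Longrightarrow> j < n \<Longrightarrow> r ^ j \<notin> K"
    and "degree g < n" "\<And>i. coeff g i \<in> K" "poly g r = 0"
  shows "g = 0"
proof (rule ccontr)
  assume "g \<noteq> 0"
  then obtain k where "0 < k" "k \<le> degree g" "r ^ k \<in> K"
    using power_closed_of_root[OF assms(1,2)] assms(5,6) by blast
  then show False using assms(3)[of k] assms(4) by simp
qed

end

section \<open>Roots of a depressed cubic\<close>

lemma poly_real_depressed_cubic:
  "poly (real_poly (depressed_cubic p q)) y = y ^ 3 + of_rat p * y + of_rat q"
  by (simp add: depressed_cubic_def algebra_simps power3_eq_cube)

lemma rational_root_iff:
  "(\<exists>y. poly (depressed_cubic p q) y = 0) \<longleftrightarrow>
   (\<exists>y \<in> \<rat>. poly (real_poly (depressed_cubic p q)) y = 0)"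
proof -
  have "poly (real_poly (depressed_cubic p q)) (of_rat y) = 0 \<longleftrightarrow> poly (depressed_cubic p q) y = 0" for y
    by (simp add: poly_real_poly_of_rat)
  then show ?thesis by (metis Rats_cases Rats_of_rat)
qed

lemma quadratic_irrational_zero:
  fixes s :: real
  assumes "s \<notin> \<rat>" "a \<in> \<rat>" "b \<in> \<rat>" "a + b * s = 0"
  shows "a = 0 \<and> b = 0"
proof -
  have "b = 0"
  proof (rule ccontr)
    assume "b \<noteq> 0"
    with assms(4) have "s = - a / b" by (simp add: field_simps)
    with assms(1-3) show False by simp
  qed
  with assms(4) show ?thesis by simp
qed

text \<open>Multiplication by the conjugate \<open>c - d * s\<close> makes the denominator rational.\<close>
lemma quotient_in_quadratic_field:
  fixes s x :: real
  assumes "s ^ 2 \<in> \<rat>" "s \<notin> \<rat>" "a \<in> \<rat>" "b \<in> \<rat>" "c \<in> \<rat>" "d \<in> \<rat>" "c + d * s \<noteq> 0"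
    and eq: "(c + d * s) * x = a + b * s"
  obtains u v where "u \<in> \<rat>" "v \<in> \<rat>" "x = u + v * s"
proof -
  define N where "N = c ^ 2 - d ^ 2 * s ^ 2"
  have N: "N = (c + d * s) * (c - d * s)"
    by (simp add: N_def algebra_simps power2_eq_square)
  have "c - d * s \<noteq> 0"
    using quadratic_irrational_zero[of s c "- d"] assms by auto
  then have "N \<noteq> 0" using assms(7) N by simp
  have "N * x = (c - d * s) * (a + b * s)"
    by (simp add: N eq[symmetric])
  also have "\<dots> = (a * c - b * d * s ^ 2) + (b * c - a * d) * s"
    by (simp add: algebra_simps power2_eq_square)
  finally have "x = ((a * c - b * d * s ^ 2) + (b * c - a * d) * s) / N"
    using \<open>N \<noteq> 0\<close> by (simp add: eq_divide_eq mult.commute)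
  then have "x = (a * c - b * d * s ^ 2) / N + (b * c - a * d) / N * s"
    by (simp add: add_divide_distrib)
  moreover have "N \<in> \<rat>" using assms by (simp add: N_def)
  then have "(a * c - b * d * s ^ 2) / N \<in> \<rat>" "(b * c - a * d) / N \<in> \<rat>"
    using assms by simp_all
  ultimately show ?thesis using that by blast
qed

text \<open>
  The conjugate \<open>u - v * s\<close> is a second root. The three roots sum to zero, because the cubic has no
  quadratic term, so the third one is \<open>- 2 * u\<close>.
\<close>
lemma rational_root_of_quadratic_root:
  assumes "s ^ 2 \<in> \<rat>" "s \<notin> \<rat>" "u \<in> \<rat>" "v \<in> \<rat>" "u + v * s \<notin> \<rat>"
    and root: "poly (real_poly (depressed_cubic p q)) (u + v * s) = 0"
  shows "poly (real_poly (depressed_cubic p q)) (- 2 * u) = 0"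
proof -
  define e where "e = s ^ 2"
  let ?p = "of_rat p :: real" and ?q = "of_rat q :: real"
  let ?A = "u ^ 3 + 3 * u * v ^ 2 * e + ?p * u + ?q" and ?B = "v * (3 * u ^ 2 + v ^ 2 * e + ?p)"
  have "(u + v * s) ^ 3 + ?p * (u + v * s) + ?q = ?A + ?B * s"
    unfolding e_def by algebra
  with root have "?A + ?B * s = 0" by (simp only: poly_real_depressed_cubic)
  moreover have "?A \<in> \<rat>" "?B \<in> \<rat>" using assms by (simp_all add: e_def)
  ultimately have "?A = 0 \<and> ?B = 0" using quadratic_irrational_zero assms(2) by blast
  moreover have "v \<noteq> 0" using assms by auto
  ultimately have A: "?A = 0" and B: "?p = - (3 * u ^ 2 + v ^ 2 * e)" by auto
  have "(- 2 * u) ^ 3 + ?p * (- 2 * u) + ?q = ?A"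
    unfolding B by (simp add: power2_eq_square power3_eq_cube algebra_simps)
  with A show ?thesis by (simp only: poly_real_depressed_cubic)
qed

text \<open>
  The new radical \<open>s\<close> is the first positive power of \<open>r\<close> that lies in \<open>\<rat>(x)\<close>; that it lies there bounds its
  degree over \<open>\<rat>\<close>, and degree \<open>2\<close> is excluded because the cubic has no rational root.
\<close>
lemma cubic_root_in_simple_radical:
  assumes irr: "\<And>y. y \<in> \<rat> \<Longrightarrow> poly (real_poly (depressed_cubic p q)) y \<noteq> 0"
    and m: "m > 0" "r ^ m \<in> \<rat>"
    and x: "x \<in> rat_adjoin r" "poly (real_poly (depressed_cubic p q)) x = 0"
  shows "\<exists>s. \<exists>a \<in> \<rat>. \<exists>b \<in> \<rat>. \<exists>c \<in> \<rat>. s ^ 3 \<in> \<rat> \<and> x = a + b * s + c * s ^ 2"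
proof -
  let ?f = "depressed_cubic p q"
  have f: "?f \<noteq> 0" "degree ?f = 3" by (simp_all add: depressed_cubic_def)
  interpret Q: real_subfield \<rat> by (rule real_subfield_Rats)
  interpret K: real_subfield "rat_adjoin x" by (rule real_subfield_rat_adjoin[OF f(1) x(2)])
  have x_irr: "x \<notin> \<rat>" using irr x(2) by blast
  have Rats_K: "\<rat> \<subseteq> rat_adjoin x" using of_rat_in_rat_adjoin by (auto elim!: Rats_cases)
  define k where "k = (LEAST k. 0 < k \<and> r ^ k \<in> rat_adjoin x)"
  have k: "0 < k" "r ^ k \<in> rat_adjoin x"
    using LeastI[of "\<lambda>k. 0 < k \<and> r ^ k \<in> rat_adjoin x" m] m Rats_K by (auto simp: k_def)
  have k_min: "r ^ j \<notin> rat_adjoin x" if "0 < j" "j < k" for j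
    using not_less_Least[of j "\<lambda>k. 0 < k \<and> r ^ k \<in> rat_adjoin x"] that by (auto simp: k_def)
  define s where "s = r ^ k"
  have s_K: "s \<in> rat_adjoin x" using k(2) by (simp add: s_def)
  have s_irr: "s \<notin> \<rat>"
  proof
    assume "s \<in> \<rat>"
    then obtain c where c: "s = of_rat c" by (elim Rats_cases)
    let ?g = "monom 1 k - [:c:]"
    have "coeff ?g k = 1" using k(1) by (simp add: coeff_pCons split: nat.split)
    then have "?g \<noteq> 0" by (metis coeff_0 zero_neq_one)
    moreover have "poly (real_poly ?g) r = 0"
      using c by (simp add: s_def poly_monom of_rat_minus diff_conv_add_uminus del: add_uminus_conv_diff)
    ultimately obtain B where B: "degree B < degree ?g" "x = poly (real_poly B) r"
      using x(1) by (rule rat_adjoin_reduce)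
    have "degree ?g \<le> k" by (intro degree_diff_le) (simp_all add: degree_monom_le)
    with B(1) have deg: "degree B < k" by simp
    \<comment> \<open>A polynomial over \<open>\<rat>(x)\<close> of degree below \<open>k\<close> with root \<open>r\<close>: it must vanish, so \<open>B\<close> is constant.\<close>
    let ?h = "real_poly B - [:x:]"
    have "coeff ?h i \<in> rat_adjoin x" for i
      using of_rat_in_rat_adjoin self_in_rat_adjoin
      by (cases i) (auto intro: K.diff_closed)
    moreover have "degree ?h < k" using deg by (intro degree_diff_less) auto
    moreover have "poly ?h r = 0" using B(2) by simp
    ultimately have "?h = 0"
      using K.poly_eq_0_of_degree_less[of k r k ?h] k k_min by blast
    then have "coeff ?h 0 = 0" by simp
    then have "x = of_rat (coeff B 0)" by simp
    with x_irr show False by simp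
  qed
  have "s ^ m \<in> \<rat>"
    using m(2) by (metis Rats_power mult.commute power_mult s_def)
  define n where "n = (LEAST n. 0 < n \<and> s ^ n \<in> \<rat>)"
  have n: "0 < n" "s ^ n \<in> \<rat>"
    using LeastI[of "\<lambda>n. 0 < n \<and> s ^ n \<in> \<rat>" m] m \<open>s ^ m \<in> \<rat>\<close> by (auto simp: n_def)
  have n_min: "s ^ j \<notin> \<rat>" if "0 < j" "j < n" for j
    using not_less_Least[of j "\<lambda>n. 0 < n \<and> s ^ n \<in> \<rat>"] that by (auto simp: n_def)
  have indep: "A = 0" if "degree A < n" "poly (real_poly A) s = 0" for A
    using Q.poly_eq_0_of_degree_less[of n s n "real_poly A"] n n_min that by simp
  have "n \<noteq> 1" using n(2) s_irr by auto
  have "n \<le> 3"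
  proof -
    obtain c :: "nat \<Rightarrow> rat" and i where c: "i \<le> 3" "c i \<noteq> 0" "(\<Sum>i\<le>3. of_rat (c i) * s ^ i) = 0"
      using rat_adjoin_dependent[OF f(1) x(2), of "\<lambda>i. s ^ i"] rat_adjoin_power[OF s_K] f(2)
      by metis
    let ?A = "\<Sum>i\<le>3. monom (c i) i"
    have "coeff ?A i = c i" using c(1) by (simp add: coeff_sum)
    then have "?A \<noteq> 0" using c(2) by (metis coeff_0)
    moreover have "poly (real_poly ?A) s = 0"
      using c(3) by (simp add: numeral_3_eq_3 poly_monom)
    moreover have "degree ?A \<le> 3"
      by (intro degree_sum_le) (auto intro: order_trans[OF degree_monom_le])
    ultimately show ?thesis using indep[of ?A] by fastforce
  qed
  with n(1) \<open>n \<noteq> 1\<close> consider "n = 2" | "n = 3" by linarith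
  then show ?thesis
  proof cases
    case 1
    \<comment> \<open>A relation between these four elements of \<open>\<rat>(x)\<close> puts \<open>x\<close> into \<open>\<rat>(s)\<close>.\<close>
    define w where "w i = [1, s, x, s * x] ! i" for i
    have "w i \<in> rat_adjoin x" if "i \<le> 3" for i
    proof -
      from that have "i = 0 \<or> i = 1 \<or> i = 2 \<or> i = 3" by linarith
      then show ?thesis
        using K.one_closed s_K self_in_rat_adjoin[of x] K.mult_closed
        by (auto simp: w_def)
    qed
    then obtain c :: "nat \<Rightarrow> rat" and i
      where c: "i \<le> 3" "c i \<noteq> 0" "(\<Sum>i\<le>3. of_rat (c i) * w i) = 0"
      using rat_adjoin_dependent[OF f(1) x(2), of w] f(2) by metis
    let ?c = "\<lambda>i. of_rat (c i) :: real"
    have rel: "(?c 2 + ?c 3 * s) * x = - ?c 0 + - ?c 1 * s"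
      using c(3) by (simp add: w_def numeral_3_eq_3 numeral_2_eq_2 algebra_simps)
    have lin: "b = 0 \<and> d = 0" if "of_rat b + of_rat d * s = 0" for b d
      using indep[of "[:b, d:]"] that 1 by (auto simp: algebra_simps)
    have "?c 2 + ?c 3 * s \<noteq> 0"
    proof
      assume 0: "?c 2 + ?c 3 * s = 0"
      with rel have "?c 0 + ?c 1 * s = 0" by simp
      with 0 have "c 0 = 0 \<and> c 1 = 0 \<and> c 2 = 0 \<and> c 3 = 0" using lin by blast
      moreover from c(1) have "i = 0 \<or> i = 1 \<or> i = 2 \<or> i = 3" by linarith
      ultimately show False using c(2) by auto
    qed
    then obtain u v where "u \<in> \<rat>" "v \<in> \<rat>" "x = u + v * s"
      using quotient_in_quadratic_field[OF _ s_irr _ _ _ _ _ rel] n(2) 1 by auto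
    then have "poly (real_poly ?f) (- 2 * u) = 0"
      using rational_root_of_quadratic_root[of s u v p q] n(2) 1 s_irr x_irr x(2) by auto
    then show ?thesis using irr \<open>u \<in> \<rat>\<close> by auto
  next
    case 2
    \<comment> \<open>The first three are independent over \<open>\<rat>\<close>, so a relation can be solved for \<open>x\<close>.\<close>
    define w where "w i = [1, s, s ^ 2, x] ! i" for i
    have "w i \<in> rat_adjoin x" if "i \<le> 3" for i
    proof -
      from that have "i = 0 \<or> i = 1 \<or> i = 2 \<or> i = 3" by linarith
      then show ?thesis
        using K.one_closed s_K self_in_rat_adjoin[of x] rat_adjoin_power[of s x 2]
        by (auto simp: w_def)
    qed
    then obtain c :: "nat \<Rightarrow> rat" and i
      where c: "i \<le> 3" "c i \<noteq> 0" "(\<Sum>i\<le>3. of_rat (c i) * w i) = 0"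
      using rat_adjoin_dependent[OF f(1) x(2), of w] f(2) by metis
    let ?c = "\<lambda>i. of_rat (c i) :: real"
    have rel: "?c 0 + ?c 1 * s + ?c 2 * s ^ 2 + ?c 3 * x = 0"
      using c(3) by (simp add: w_def numeral_3_eq_3 numeral_2_eq_2 algebra_simps)
    have "c 3 \<noteq> 0"
    proof
      assume 3: "c 3 = 0"
      have "poly (real_poly [:c 0, c 1, c 2:]) s = ?c 0 + ?c 1 * s + ?c 2 * s ^ 2"
        by (simp add: algebra_simps power2_eq_square)
      also have "\<dots> = 0" using rel 3 by simp
      finally have "[:c 0, c 1, c 2:] = 0" using 2 by (intro indep) simp_all
      moreover from c(1) have "i = 0 \<or> i = 1 \<or> i = 2 \<or> i = 3" by linarith
      ultimately show False using c(2) 3 by auto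
    qed
    moreover have "?c 3 * x = - ?c 0 + - ?c 1 * s + - ?c 2 * s ^ 2" using rel by simp
    ultimately have "x = (- ?c 0 + - ?c 1 * s + - ?c 2 * s ^ 2) / ?c 3"
      by (simp add: eq_divide_eq mult.commute)
    then have "x = - ?c 0 / ?c 3 + - ?c 1 / ?c 3 * s + - ?c 2 / ?c 3 * s ^ 2"
      by (simp add: add_divide_distrib diff_divide_distrib)
    moreover have "s ^ 3 \<in> \<rat>" using n(2) 2 by simp
    moreover have "- ?c j / ?c 3 \<in> \<rat>" for j by simp
    ultimately show ?thesis by blast
  qed
qed

text \<open>
  Since the cubic has no rational root, \<open>r\<close> is irrational and \<open>1, r, r\<^sup>2\<close> are independent over \<open>\<rat>\<close>, so
  the three coefficients of the value at \<open>a + b * r + c * r ^ 2\<close> vanish. Eliminating \<open>p\<close> from the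
  last two leaves \<open>a * (c ^ 3 * r ^ 3 - b ^ 3) = 0\<close>, whose second factor vanishes only if \<open>r\<close> is
  rational or \<open>b\<close> and \<open>c\<close> are both zero.
\<close>
lemma cubic_D_square_of_simple_radical_root:
  assumes irr: "\<And>y. y \<in> \<rat> \<Longrightarrow> poly (real_poly (depressed_cubic p q)) y \<noteq> 0"
    and abc: "a \<in> \<rat>" "b \<in> \<rat>" "c \<in> \<rat>" and r3: "r ^ 3 \<in> \<rat>"
    and root: "poly (real_poly (depressed_cubic p q)) (a + b * r + c * r ^ 2) = 0"
  shows "\<exists>d \<in> \<rat>. of_rat (cubic_D p q) = (d :: real) ^ 2"
proof -
  interpret Q: real_subfield \<rat> by (rule real_subfield_Rats)
  define R where "R = r ^ 3"
  have RQ: "R \<in> \<rat>" using r3 by (simp add: R_def)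
  let ?p = "of_rat p :: real" and ?q = "of_rat q :: real"
  have r1: "r \<notin> \<rat>" using irr root abc by auto
  have r2: "r ^ 2 \<notin> \<rat>"
  proof
    assume "r ^ 2 \<in> \<rat>"
    then have "R / r ^ 2 \<in> \<rat>" using RQ by simp
    moreover have "R / r ^ 2 = r"
      by (cases "r = 0") (simp_all add: R_def power3_eq_cube power2_eq_square)
    ultimately show False using r1 by simp
  qed
  have indep: "u = 0 \<and> v = 0 \<and> w = 0"
    if uvw: "u \<in> \<rat>" "v \<in> \<rat>" "w \<in> \<rat>" and rel: "u + v * r + w * r ^ 2 = 0" for u v w
  proof -
    have "[:u, v, w:] = 0"
    proof (rule Q.poly_eq_0_of_degree_less)
      show "r ^ j \<notin> \<rat>" if "0 < j" "j < 3" for j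
      proof -
        from that have "j = 1 \<or> j = 2" by linarith
        then show ?thesis using r1 r2 by auto
      qed
      show "coeff [:u, v, w:] i \<in> \<rat>" for i
        using uvw by (auto simp: coeff_pCons split: nat.splits)
      show "poly [:u, v, w:] r = 0" using rel by (simp add: algebra_simps power2_eq_square)
    qed (use r3 in auto)
    then show ?thesis by simp
  qed
  let ?C0 = "a ^ 3 + 6 * a * b * c * R + b ^ 3 * R + c ^ 3 * R ^ 2 + ?p * a + ?q"
  let ?C1 = "3 * a ^ 2 * b + 3 * a * c ^ 2 * R + 3 * b ^ 2 * c * R + ?p * b"
  let ?C2 = "3 * a ^ 2 * c + 3 * a * b ^ 2 + 3 * b * c ^ 2 * R + ?p * c"
  have "?C0 + ?C1 * r + ?C2 * r ^ 2 = poly (real_poly (depressed_cubic p q)) (a + b * r + c * r ^ 2)"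
    unfolding poly_real_depressed_cubic R_def by algebra
  also have "\<dots> = 0" by (rule root)
  finally have "?C0 = 0 \<and> ?C1 = 0 \<and> ?C2 = 0"
    using abc RQ by (intro indep) simp_all
  then have C: "?C0 = 0" "?C1 = 0" "?C2 = 0" by blast+
  have bc: "b \<noteq> 0 \<or> c \<noteq> 0" using irr root abc by auto
  have "c ^ 3 * R \<noteq> b ^ 3"
  proof
    assume eq: "c ^ 3 * R = b ^ 3"
    then have "(c * r) ^ 3 = b ^ 3" by (simp add: R_def power_mult_distrib)
    then have cr: "c * r = b" by (metis odd_numeral odd_real_root_power_cancel)
    with bc have "c \<noteq> 0" by auto
    with cr have "r = b / c" by (simp add: field_simps)
    with r1 abc show False by simp
  qed
  moreover have "a * (c ^ 3 * R - b ^ 3) = 0" using C(2,3) by algebra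
  ultimately have a0: "a = 0" by simp
  have p: "?p = - 3 * b * c * R"
  proof -
    have "b * (3 * b * c * R + ?p) = 0" "c * (3 * b * c * R + ?p) = 0"
      using C(2,3) a0 by algebra+
    with bc have "3 * b * c * R + ?p = 0" by auto
    then show ?thesis by simp
  qed
  have q: "?q = - (b ^ 3 * R + c ^ 3 * R ^ 2)" using C(1) a0 by simp
  have "of_rat (cubic_D p q) = (?p / 3) ^ 3 + (?q / 2) ^ 2"
    by (simp add: cubic_D_def of_rat_add of_rat_power of_rat_divide)
  also have "\<dots> = ((b ^ 3 * R - c ^ 3 * R ^ 2) / 2) ^ 2"
    unfolding p q by (simp add: field_simps) algebra
  finally show ?thesis using abc RQ by (intro bexI[of _ "(b ^ 3 * R - c ^ 3 * R ^ 2) / 2"]) simp_all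
qed

text \<open>
  Cardano's root is \<open>r + t\<close> with \<open>r ^ 3 = - q / 2 + d\<close> and \<open>r * t = - p / 3\<close>. For \<open>r \<noteq> 0\<close> the second
  cube root is \<open>t = c * r ^ 2\<close> with \<open>c = - p / (3 * r ^ 3)\<close>, so one radical suffices. For
  \<open>d = q / 2\<close> the cubic degenerates to \<open>x ^ 3 + q\<close>.
\<close>
lemma cardano_root:
  fixes p q d :: real
  assumes "d ^ 2 = (p / 3) ^ 3 + (q / 2) ^ 2" "p \<in> \<rat>" "q \<in> \<rat>" "d \<in> \<rat>"
  shows "\<exists>r. \<exists>b \<in> \<rat>. \<exists>c \<in> \<rat>. r ^ 3 \<in> \<rat> \<and> (b * r + c * r ^ 2) ^ 3 + p * (b * r + c * r ^ 2) + q = 0"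
proof (cases "d = q / 2")
  case True
  then have "(p / 3) ^ 3 = 0" using assms(1) by (simp only: True)
  then have "p = 0" by simp
  moreover have "root 3 (- q) ^ 3 = - q" by (simp add: odd_real_root_pow)
  ultimately show ?thesis
    using assms by (intro exI[of _ "root 3 (- q)"] bexI[of _ 1] bexI[of _ 0]) simp_all
next
  case False
  define R where "R = - q / 2 + d"
  define r where "r = root 3 R"
  have r3: "r ^ 3 = R" by (simp add: r_def odd_real_root_pow)
  have R: "R \<noteq> 0" using False by (simp add: R_def)
  define c where "c = - p / (3 * R)"
  have cR: "3 * c * R = - p" using R by (simp add: c_def)
  have "c * R = - (p / 3)" using cR by simp
  then have "(c * R) ^ 3 = - ((p / 3) ^ 3)" by (simp add: power3_eq_cube)
  moreover have "R ^ 2 + q * R = d ^ 2 - (q / 2) ^ 2"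
    unfolding R_def by (simp add: power2_eq_square algebra_simps)
  moreover have "R * (c ^ 3 * R ^ 2 + R + q) = (c * R) ^ 3 + (R ^ 2 + q * R)"
    by (simp add: algebra_simps power2_eq_square power3_eq_cube)
  ultimately have "R * (c ^ 3 * R ^ 2 + R + q) = 0"
    using assms(1) by linarith
  then have cq: "c ^ 3 * R ^ 2 + R + q = 0" using R by simp
  have "(1 * r + c * r ^ 2) ^ 3 + p * (1 * r + c * r ^ 2) + q
      = (c ^ 3 * R ^ 2 + R + q) + (3 * c * R + p) * (r + c * r ^ 2)"
    by (simp add: r3[symmetric] algebra_simps power2_eq_square power3_eq_cube)
  also have "\<dots> = 0" using cq cR by simp
  finally have "(1 * r + c * r ^ 2) ^ 3 + p * (1 * r + c * r ^ 2) + q = 0" .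
  moreover have "R \<in> \<rat>" using assms by (simp add: R_def)
  moreover from this have "c \<in> \<rat>" using assms by (simp add: c_def)
  ultimately show ?thesis using r3 Rats_1 by metis
qed

theorem theorem2:
  fixes p q :: rat
  defines "cond_i \<equiv> one_solvable (depressed_cubic p q)"
    and "cond_ii \<equiv> (\<exists>r :: real. \<exists>a \<in> \<rat>. \<exists>b \<in> \<rat>. \<exists>c \<in> \<rat>. r ^ 3 \<in> \<rat> \<and>
           poly (real_poly (depressed_cubic p q)) (a + b * r + c * r ^ 2) = 0)"
    and "cond_iii \<equiv> (\<exists>x :: rat. poly (depressed_cubic p q) x = 0) \<or>
           (cubic_D p q \<ge> 0 \<and> sqrt (of_rat (cubic_D p q)) \<in> \<rat>)"
  shows "(cond_i \<longleftrightarrow> cond_ii) \<and> (cond_ii \<longleftrightarrow> cond_iii)"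
proof -
  let ?f = "real_poly (depressed_cubic p q)"
  have rational: cond_ii if "y \<in> \<rat>" "poly ?f y = 0" for y
    unfolding cond_ii_def using that
    by (intro exI[of _ 0] bexI[of _ y] bexI[of _ 0]) simp_all
  have i_ii: cond_ii if i: cond_i
  proof (cases "\<exists>y \<in> \<rat>. poly ?f y = 0")
    case True
    then show ?thesis using rational by blast
  next
    case False
    from i obtain r m x where rx: "m > 0" "r ^ m \<in> \<rat>" "x \<in> rat_adjoin r" "poly ?f x = 0"
      unfolding cond_i_def one_solvable_def by blast
    obtain s a b c where "a \<in> \<rat>" "b \<in> \<rat>" "c \<in> \<rat>" "s ^ 3 \<in> \<rat>" "x = a + b * s + c * s ^ 2"
      using cubic_root_in_simple_radical[OF _ rx] False by blast
    then show ?thesis using rx(4) unfolding cond_ii_def by blast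
  qed
  have ii_i: cond_i if ii: cond_ii
  proof -
    from ii obtain r a b c where abc: "a \<in> \<rat>" "b \<in> \<rat>" "c \<in> \<rat>" "r ^ 3 \<in> \<rat>"
        and root: "poly ?f (a + b * r + c * r ^ 2) = 0"
      unfolding cond_ii_def by blast
    from abc obtain a' b' c' where "a = of_rat a'" "b = of_rat b'" "c = of_rat c'"
      by (auto elim!: Rats_cases)
    then have "a + b * r + c * r ^ 2 = poly (real_poly [:a', b', c':]) r"
      by (simp add: algebra_simps power2_eq_square)
    then have "a + b * r + c * r ^ 2 \<in> rat_adjoin r" by (simp only: rat_adjoin_I)
    with abc(4) root show ?thesis
      unfolding cond_i_def one_solvable_def by (intro exI[of _ r] conjI exI[of _ 3]) auto
  qed
  have ii_iii: cond_iii if ii: cond_ii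
  proof (cases "\<exists>y \<in> \<rat>. poly ?f y = 0")
    case True
    then show ?thesis unfolding cond_iii_def rational_root_iff by blast
  next
    case False
    from ii obtain r a b c where abc: "a \<in> \<rat>" "b \<in> \<rat>" "c \<in> \<rat>" "r ^ 3 \<in> \<rat>"
        "poly ?f (a + b * r + c * r ^ 2) = 0"
      unfolding cond_ii_def by blast
    then obtain d :: real where d: "d \<in> \<rat>" "of_rat (cubic_D p q) = d ^ 2"
      using cubic_D_square_of_simple_radical_root[OF _ abc] False by blast
    have "(0 :: real) \<le> of_rat (cubic_D p q)" by (simp add: d(2))
    then have "cubic_D p q \<ge> 0" by simp
    then show ?thesis unfolding cond_iii_def by (simp add: d)
  qed
  have iii_ii: cond_ii if iii: cond_iii
  proof (cases "\<exists>y \<in> \<rat>. poly ?f y = 0")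
    case True
    then show ?thesis using rational by blast
  next
    case False
    with iii have D: "cubic_D p q \<ge> 0" "sqrt (of_rat (cubic_D p q)) \<in> \<rat>"
      unfolding cond_iii_def rational_root_iff by blast+
    have "sqrt (of_rat (cubic_D p q)) ^ 2 = of_rat (cubic_D p q)" using D(1) by simp
    also have "\<dots> = (of_rat p / 3) ^ 3 + (of_rat q / 2) ^ 2"
      by (simp add: cubic_D_def of_rat_add of_rat_power of_rat_divide)
    finally have sq: "sqrt (of_rat (cubic_D p q)) ^ 2 = (of_rat p / 3) ^ 3 + (of_rat q / 2) ^ 2" .
    obtain r b c :: real where bc: "b \<in> \<rat>" "c \<in> \<rat>" "r ^ 3 \<in> \<rat>"
        and "(b * r + c * r ^ 2) ^ 3 + of_rat p * (b * r + c * r ^ 2) + of_rat q = 0"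
      using cardano_root[OF sq Rats_of_rat Rats_of_rat D(2)] by blast
    then have "poly ?f (0 + b * r + c * r ^ 2) = 0"
      by (simp only: poly_real_depressed_cubic add_0)
    with bc show ?thesis unfolding cond_ii_def using Rats_0 by blast
  qed
  show ?thesis using i_ii ii_i ii_iii iii_ii by blast
qed

end
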